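(* Let $\mathbf\Phi(\mathbf N,\mathbf f_k,\Delta t)$ be an order-$p$ increment function. The step-truncation method $$\mathbf a_k=\mathbf f_k+\Delta t\,\mathbf\Phi(\mathbf N,\mathbf f_k,\Delta t),\qquad \mathbf f_{k+1}=\mathfrak T^{\rm best}_{\mathbf r_k}(\mathbf a_k),$$ approximates $\frac{d\mathbf f}{dt}=\mathbf N(\mathbf f)$ with order-$p$ local truncation error if and only if there exists an $M>0$ (independent of $k$ and $\Delta t$) such that the rank $\mathbf r_k$ at time index $k$ satisfies $$\left\|\mathbf a_k-\mathfrak T^{\rm best}_{\mathbf r_k}(\mathbf a_k)\right\|_2\le M\Delta t^{p+1}.$$
   Context: Throughout, $d\ge2$, $\|\cdot\|_2$ is the Euclidean (Frobenius) norm on $\mathbb R^{n_1\times\cdots\times n_d}$, $\mathbf N$ is a map from this space to itself, $\Delta t>0$ is a (sufficiently small) time step and $t_k=k\Delta t$. Increment function of order $p$: $\mathbf\Phi(\mathbf N,\cdot,\Delta t)$ maps tensors to tensors, and there is a constant $K$, independent of $k$ and $\Delta t$, such that $\|\mathbf f(t_{k+1})-(\mathbf f_k+\Delta t\,\mathbf\Phi(\mathbf N,\mathbf f_k,\Delta t))\|_2\le K\Delta t^{p+1}$ for all sufficiently small $\Delta t$, where $\mathbf f(t)$ is the exact solution of $\frac{d\mathbf f}{dt}=\mathbf N(\mathbf f)$ with $\mathbf f(t_k)=\mathbf f_k$. Order-$p$ local truncation error of the step-truncation method: there is a constant $C_1$, independent of $k$ and $\Delta t$, with $\|\mathbf f(t_{k+1})-\mathbf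 f_{k+1}\|_2\le C_1\Delta t^{p+1}$, where again $\mathbf f(t)$ is the exact solution with $\mathbf f(t_k)=\mathbf f_k$. Hierarchical Tucker format: fix a dimension tree $\mathcal T_d$ (binary tree with root $\{1,\dots,d\}$, leaves the singletons, every non-leaf node the disjoint union of its two children). For $\alpha\in\mathcal T_d$, $\mathbf f^{(\alpha)}$ is the matricization of $\mathbf f$ with rows indexed by the modes in $\alpha$ and columns by the others. For $\mathbf r=\{r_\alpha\}$, $\mathcal H_{\mathbf r}=\{\mathbf f:\operatorname{rank}\mathbf f^{(\alpha)}=r_\alpha\ \forall\alpha\}$, with closure $\overline{\mathcal H}_{\mathbf r}=\{\mathbf f:\operatorname{rank}\mathbf f^{(\alpha)}\le r_\alpha\ \forall\alpha\}$. Best truncation: $\mathfrak T^{\rm best}_{\mathbf r}(\mathbf f)\in\operatorname{argmin}_{\mathbf h\in\overline{\mathcal H}_{\mathbf r}}\|\mathbf f-\mathbf h\|_2$ (a fixed choice of minimizer). The rank $\mathbf r_k$ may change from step to step. *)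

theory Defs
  imports "HOL-Analysis.Analysis" "HOL-Library.Function_Algebras"
begin

type_synonym tensor = "(nat \<Rightarrow> nat) \<Rightarrow> real"

definition multi_indices :: "(nat \<Rightarrow> nat) \<Rightarrow> nat set \<Rightarrow> (nat \<Rightarrow> nat) set" where
  "multi_indices n \<alpha> = (\<Pi>\<^sub>E \<mu>\<in>\<alpha>. {1..n \<mu>})"

text \<open>The space of real \<open>n 1 \<times> \<dots> \<times> n d\<close> arrays: functions on multi-indices, set to \<open>0\<close> outside
  the index box so that equal arrays are equal functions.\<close>

definition tensors :: "nat \<Rightarrow> (nat \<Rightarrow> nat) \<Rightarrow> tensor set" where
  "tensors d n = {f. \<forall>i. i \<notin> multi_indices n {1..d} \<longrightarrow> f i = 0}"

definition tnorm :: "nat \<Rightarrow> (nat \<Rightarrow> nat) \<Rightarrow> tensor \<Rightarrow> real" where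
  "tnorm d n f = L2_set f (multi_indices n {1..d})"

text \<open>Here \<open>merge \<alpha> \<beta> (i, j)\<close> is the multi-index that agrees with \<open>i\<close> on \<open>\<alpha>\<close> and with \<open>j\<close> on \<open>\<beta>\<close>.\<close>

definition matricization ::
    "nat \<Rightarrow> (nat \<Rightarrow> nat) \<Rightarrow> nat set \<Rightarrow> tensor \<Rightarrow> (nat \<Rightarrow> nat) \<Rightarrow> (nat \<Rightarrow> nat) \<Rightarrow> real" where
  "matricization d n \<alpha> f i j =
     (if i \<in> multi_indices n \<alpha> \<and> j \<in> multi_indices n ({1..d} - \<alpha>)
      then f (merge \<alpha> ({1..d} - \<alpha>) (i, j)) else 0)"

text \<open>Matrices with arbitrary index sets are functions of two arguments; the rank over a set \<open>J\<close> of
  column indices is the dimension of the span of the columns, as vectors in the real vector space of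
  functions under pointwise operations.\<close>

definition fun_scale :: "real \<Rightarrow> ('a \<Rightarrow> real) \<Rightarrow> 'a \<Rightarrow> real" where
  "fun_scale c v = (\<lambda>x. c * v x)"

lemma vector_space_fun_scale: "vector_space fun_scale"
  by unfold_locales (auto simp: fun_scale_def fun_eq_iff algebra_simps)

definition matrix_rank :: "('a \<Rightarrow> 'b \<Rightarrow> real) \<Rightarrow> 'b set \<Rightarrow> nat" where
  "matrix_rank A J = vector_space.dim fun_scale ((\<lambda>j i. A i j) ` J)"

definition matricization_rank :: "nat \<Rightarrow> (nat \<Rightarrow> nat) \<Rightarrow> nat set \<Rightarrow> tensor \<Rightarrow> nat" where
  "matricization_rank d n \<alpha> f =
     matrix_rank (matricization d n \<alpha> f) (multi_indices n ({1..d} - \<alpha>))"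

text \<open>\<open>dimension_tree A \<T>\<close>: \<open>\<T>\<close> is the set of nodes of a binary tree with root \<open>A\<close> whose leaves are
  singletons and whose inner nodes are the disjoint union of their two children.\<close>

inductive dimension_tree :: "nat set \<Rightarrow> nat set set \<Rightarrow> bool" where
  leaf: "dimension_tree {\<mu>} {{\<mu>}}"
| node: "dimension_tree A S \<Longrightarrow> dimension_tree B T \<Longrightarrow> A \<inter> B = {} \<Longrightarrow>
         dimension_tree (A \<union> B) (insert (A \<union> B) (S \<union> T))"

definition ht_closure ::
    "nat \<Rightarrow> (nat \<Rightarrow> nat) \<Rightarrow> nat set set \<Rightarrow> (nat set \<Rightarrow> nat) \<Rightarrow> tensor set" where
  "ht_closure d n \<T> r = {f \<in> tensors d n. \<forall>\<alpha>\<in>\<T>. matricization_rank d n \<alpha> f \<le> r \<alpha>}"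

text \<open>\<open>T\<close> is a fixed choice, for every rank and every tensor, of a nearest point; nearest points need
  not be unique.\<close>

definition best_truncation ::
    "nat \<Rightarrow> (nat \<Rightarrow> nat) \<Rightarrow> nat set set \<Rightarrow> ((nat set \<Rightarrow> nat) \<Rightarrow> tensor \<Rightarrow> tensor) \<Rightarrow> bool" where
  "best_truncation d n \<T> T \<longleftrightarrow>
     (\<forall>r. \<forall>f\<in>tensors d n.
        is_arg_min (\<lambda>g. tnorm d n (f - g)) (\<lambda>g. g \<in> ht_closure d n \<T> r) (T r f))"

text \<open>\<open>y\<close> solves \<open>y' = N y\<close> on \<open>[a, b]\<close> with \<open>y a = x\<close>.  Since there are finitely many entries, the
  derivative of a tensor-valued curve is taken entrywise.\<close>

definition exact_solution ::
    "nat \<Rightarrow> (nat \<Rightarrow> nat) \<Rightarrow> (tensor \<Rightarrow> tensor) \<Rightarrow> real \<Rightarrow> real \<Rightarrow> tensor \<Rightarrow> (real \<Rightarrow> tensor) \<Rightarrow> bool" where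
  "exact_solution d n N a b x y \<longleftrightarrow>
     y a = x \<and>
     (\<forall>t\<in>{a..b}. y t \<in> tensors d n \<and>
        (\<forall>i\<in>multi_indices n {1..d}.
           ((\<lambda>s. y s i) has_real_derivative N (y t) i) (at t within {a..b})))"

type_synonym increment = "(tensor \<Rightarrow> tensor) \<Rightarrow> tensor \<Rightarrow> real \<Rightarrow> tensor"

definition increment_step ::
    "increment \<Rightarrow> (tensor \<Rightarrow> tensor) \<Rightarrow> real \<Rightarrow> tensor \<Rightarrow> tensor" where
  "increment_step \<Phi> N h x = x + fun_scale h (\<Phi> N x h)"

text \<open>The iterates for step size \<open>h\<close>; both the initial value and the rank used in step \<open>k\<close> may depend
  on \<open>h\<close>.\<close>

primrec step_truncation ::
    "((nat set \<Rightarrow> nat) \<Rightarrow> tensor \<Rightarrow> tensor) \<Rightarrow> increment \<Rightarrow> (tensor \<Rightarrow> tensor) \<Rightarrow>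
     (real \<Rightarrow> nat \<Rightarrow> nat set \<Rightarrow> nat) \<Rightarrow> (real \<Rightarrow> tensor) \<Rightarrow> real \<Rightarrow> nat \<Rightarrow> tensor" where
  "step_truncation T \<Phi> N r f0 h 0 = f0 h"
| "step_truncation T \<Phi> N r f0 h (Suc k) =
     T (r h k) (increment_step \<Phi> N h (step_truncation T \<Phi> N r f0 h k))"

text \<open>In the next three definitions \<open>f h k\<close> is the numerical state at time \<open>k * h\<close>, and
  ``for all sufficiently small \<open>h > 0\<close>'' is expressed by the filter \<open>at_right 0\<close>.  The constants are
  chosen before \<open>h\<close> and \<open>k\<close>.\<close>

definition locally_solvable ::
    "nat \<Rightarrow> (nat \<Rightarrow> nat) \<Rightarrow> (tensor \<Rightarrow> tensor) \<Rightarrow> (real \<Rightarrow> nat \<Rightarrow> tensor) \<Rightarrow> bool" where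
  "locally_solvable d n N f \<longleftrightarrow>
     (\<forall>\<^sub>F h in at_right 0. \<forall>k.
        \<exists>y. exact_solution d n N (real k * h) (real (Suc k) * h) (f h k) y)"

definition increment_order ::
    "nat \<Rightarrow> (nat \<Rightarrow> nat) \<Rightarrow> (tensor \<Rightarrow> tensor) \<Rightarrow> nat \<Rightarrow> increment \<Rightarrow> (real \<Rightarrow> nat \<Rightarrow> tensor) \<Rightarrow> bool" where
  "increment_order d n N p \<Phi> f \<longleftrightarrow>
     (\<forall>x\<in>tensors d n. \<forall>h>0. \<Phi> N x h \<in> tensors d n) \<and>
     (\<exists>K. \<forall>\<^sub>F h in at_right 0. \<forall>k y.
        exact_solution d n N (real k * h) (real (Suc k) * h) (f h k) y \<longrightarrow>
        tnorm d n (y (real (Suc k) * h) - increment_step \<Phi> N h (f h k)) \<le> K * h ^ (p + 1))"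

definition local_truncation_order ::
    "nat \<Rightarrow> (nat \<Rightarrow> nat) \<Rightarrow> (tensor \<Rightarrow> tensor) \<Rightarrow> nat \<Rightarrow> (real \<Rightarrow> nat \<Rightarrow> tensor) \<Rightarrow> bool" where
  "local_truncation_order d n N p f \<longleftrightarrow>
     (\<exists>C. \<forall>\<^sub>F h in at_right 0. \<forall>k y.
        exact_solution d n N (real k * h) (real (Suc k) * h) (f h k) y \<longrightarrow>
        tnorm d n (y (real (Suc k) * h) - f h (Suc k)) \<le> C * h ^ (p + 1))"

end

theory Submission
  imports Defs
begin

text \<open>
  The iterate \<open>f h (Suc k)\<close> is by construction the truncation of \<open>a h k\<close>, so the exact
  value \<open>y\<close> after one step, the untruncated value \<open>a h k\<close> and the truncated value
  \<open>f h (Suc k)\<close> form a triangle.  Its side from \<open>y\<close> to \<open>a h k\<close> is of size \<open>h ^ (p + 1)\<close> because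
  the increment function has order \<open>p\<close>; hence either of the other two sides, the local truncation
  error and the error of the rank truncation, is of that size as soon as the other one is.

  The two error bounds are quantified differently: the local truncation error is bounded over all
  exact solutions \<open>y\<close>, whereas the truncation error does not mention \<open>y\<close>.  From the truncation error
  to the local error the triangle is applied to each \<open>y\<close>; for the converse a triangle is available
  only if some \<open>y\<close> exists, and this is where local solvability enters.
\<close>

lemma tnorm_triangle: "tnorm d n (x - z) \<le> tnorm d n (x - y) + tnorm d n (y - z)"
  using L2_set_triangle_ineq[of "x - y" "y - z" "multi_indices n {1..d}"]
  by (simp add: tnorm_def fun_diff_def)

lemma tnorm_minus_commute: "tnorm d n (x - y) = tnorm d n (y - x)"
  by (simp add: tnorm_def L2_set_def power2_commute)

text \<open>The triangle argument for an arbitrary numerical state \<open>f\<close>: both error bounds measure the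
  distance from \<open>f h (Suc k)\<close>, once to the exact value and once to the increment step, and these
  two reference points are \<open>O(h ^ (p + 1))\<close> apart.\<close>

lemma local_truncation_order_iff_near_increment_step:
  assumes solvable: "locally_solvable d n N f"
    and order: "increment_order d n N p \<Phi> f"
  shows "local_truncation_order d n N p f \<longleftrightarrow>
    (\<exists>M>0. \<forall>\<^sub>F h in at_right 0. \<forall>k.
       tnorm d n (increment_step \<Phi> N h (f h k) - f h (Suc k)) \<le> M * h ^ (p + 1))"
    (is "_ \<longleftrightarrow> ?near")
proof -
  define sol where "sol h k =
    exact_solution d n N (real k * h) (real (Suc k) * h) (f h k)" for h k
  define a where "a h k = increment_step \<Phi> N h (f h k)" for h k
  obtain K where K: "\<forall>\<^sub>F h in at_right 0. \<forall>k y. sol h k y \<longrightarrow>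
      tnorm d n (y (real (Suc k) * h) - a h k) \<le> K * h ^ (p + 1)"
    using order unfolding increment_order_def sol_def a_def by blast
  show ?thesis
  proof
    assume "local_truncation_order d n N p f"
    then obtain C where C: "\<forall>\<^sub>F h in at_right 0. \<forall>k y. sol h k y \<longrightarrow>
        tnorm d n (y (real (Suc k) * h) - f h (Suc k)) \<le> C * h ^ (p + 1)"
      unfolding local_truncation_order_def sol_def by blast
    \<comment> \<open>\<open>K\<close> and \<open>C\<close> may be zero or negative, so their sum need not be an admissible \<open>M\<close>.\<close>
    define M where "M = max 1 (K + C)"
    have solv: "\<forall>\<^sub>F h in at_right 0. \<forall>k. \<exists>y. sol h k y"
      using solvable unfolding locally_solvable_def sol_def .
    have "\<forall>\<^sub>F h in at_right 0. \<forall>k. tnorm d n (a h k - f h (Suc k)) \<le> M * h ^ (p + 1)"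
      using K C solv eventually_at_right_less[of "0::real"]
    proof eventually_elim
      case (elim h)
      show ?case
      proof
        fix k
        obtain y where y: "sol h k y"
          using elim by blast
        let ?y = "y (real (Suc k) * h)"
        have "tnorm d n (a h k - f h (Suc k)) \<le> tnorm d n (?y - a h k) + tnorm d n (?y - f h (Suc k))"
          using tnorm_triangle[of d n "a h k" "f h (Suc k)" ?y] tnorm_minus_commute[of d n "a h k" ?y]
          by simp
        also have "\<dots> \<le> K * h ^ (p + 1) + C * h ^ (p + 1)"
          using elim y by (intro add_mono) blast+
        also have "\<dots> = (K + C) * h ^ (p + 1)"
          by (simp only: distrib_right)
        also have "\<dots> \<le> M * h ^ (p + 1)"
          using elim by (intro mult_right_mono) (auto simp: M_def)
        finally show "tnorm d n (a h k - f h (Suc k)) \<le> M * h ^ (p + 1)" .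
      qed
    qed
    moreover have "M > 0"
      by (simp add: M_def)
    ultimately show ?near
      unfolding a_def by blast
  next
    assume ?near
    then obtain M where M: "\<forall>\<^sub>F h in at_right 0. \<forall>k.
        tnorm d n (a h k - f h (Suc k)) \<le> M * h ^ (p + 1)"
      unfolding a_def by blast
    have "\<forall>\<^sub>F h in at_right 0. \<forall>k y. sol h k y \<longrightarrow>
        tnorm d n (y (real (Suc k) * h) - f h (Suc k)) \<le> (K + M) * h ^ (p + 1)"
      using K M
    proof eventually_elim
      case (elim h)
      show ?case
      proof (intro allI impI)
        fix k y
        assume y: "sol h k y"
        let ?y = "y (real (Suc k) * h)"
        have "tnorm d n (?y - f h (Suc k)) \<le> tnorm d n (?y - a h k) + tnorm d n (a h k - f h (Suc k))"
          by (rule tnorm_triangle)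
        also have "\<dots> \<le> K * h ^ (p + 1) + M * h ^ (p + 1)"
          using elim y by (intro add_mono) blast+
        finally show "tnorm d n (?y - f h (Suc k)) \<le> (K + M) * h ^ (p + 1)"
          by (simp only: distrib_right)
      qed
    qed
    then show "local_truncation_order d n N p f"
      unfolding local_truncation_order_def sol_def by blast
  qed
qed

theorem proposition2:
  fixes d p :: nat and n :: "nat \<Rightarrow> nat" and \<T> :: "nat set set"
    and N :: "tensor \<Rightarrow> tensor" and \<Phi> :: increment
    and T :: "(nat set \<Rightarrow> nat) \<Rightarrow> tensor \<Rightarrow> tensor"
    and r :: "real \<Rightarrow> nat \<Rightarrow> nat set \<Rightarrow> nat" and f0 :: "real \<Rightarrow> tensor"
    and f a :: "real \<Rightarrow> nat \<Rightarrow> tensor"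
  assumes "d \<ge> 2" and "\<forall>\<mu>\<in>{1..d}. n \<mu> \<ge> 1"
    and "dimension_tree {1..d} \<T>"
    and "best_truncation d n \<T> T"
    and "\<forall>x\<in>tensors d n. N x \<in> tensors d n"
    and "\<forall>h>0. f0 h \<in> tensors d n"
    and f: "f = step_truncation T \<Phi> N r f0"
    and a: "a = (\<lambda>h k. increment_step \<Phi> N h (f h k))"
    and "locally_solvable d n N f"
    and "increment_order d n N p \<Phi> f"
  shows "local_truncation_order d n N p f \<longleftrightarrow>
    (\<exists>M>0. \<forall>\<^sub>F h in at_right 0. \<forall>k.
       tnorm d n (a h k - T (r h k) (a h k)) \<le> M * h ^ (p + 1))"
proof -
  have "f h (Suc k) = T (r h k) (a h k)" for h k
    by (simp add: f a)
  then show ?thesis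
    using local_truncation_order_iff_near_increment_step[OF assms(9,10)]
    by (simp add: a)
qed

end
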